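(* Fix integers $n \geq 2$ and $1\le t\le n$, and let $\alpha,\beta\in\mathbf{Q}$ satisfy $\alpha+\beta+j\neq 0$ for all integers $j$ with $n+1\le j\le 2n$ and for all integers $j$ with $2n-2t+3\le j\le 2n$. Let $\theta_1,\dots,\theta_n\in\overline{\mathbf{Q}}$ be the roots, with multiplicity, of the polynomial $\mathscr{J}_n^{(\alpha,\beta)}(x)$, let $s_k=\sum_{j=1}^n\theta_j^k$ for $k\ge 0$, and let $\Delta_t=\det(s_{i+j})_{0\le i,j\le t-1}$. Then $$\Delta_t = \frac{A_tB_t}{C_t},$$ where $$A_t=\prod_{j=n-t+1}^n j^{\,j-(n-t)},$$ $$B_t=\prod_{j=n-t+2}^n \left[(\alpha+j)(\beta+j)\right]^{j-(n-t+1)}(\alpha+\beta+j)^{j-(n-t+2)},$$ $$C_t=\prod_{j=2n-2t+2}^{2n}(\alpha+\beta+j)^{j-(2n-2t+2)}.$$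
   Context: For $n\ge 1$ and $\alpha,\beta\in\mathbf{Q}$ with $\alpha+\beta+j\ne 0$ for $n+1\le j\le 2n$, the (monic, shifted) Jacobi polynomial is $$\mathscr{J}_n^{(\alpha,\beta)}(x) = \sum_{j=0}^n \binom{n}{j}\left(\prod_{k=j+1}^n \frac{\alpha+k}{n+\alpha+\beta+k}\right)(-1)^{n-j}x^j.$$ Conventions: $\theta^0=1$ for every root $\theta$ (so $s_0=n$), empty products equal $1$, and any factor raised to the power $0$ equals $1$. *)

theory Defs
  imports
    "HOL-Algebra.Algebraic_Closure_Type"
    "Jordan_Normal_Form.Determinant"
    "HOL-Computational_Algebra.Polynomial"
begin

(* Meaningful as a polynomial of degree n only when \<alpha> + \<beta> + j is nonzero for
   n+1 <= j <= 2n; otherwise some denominator vanishes and HOL's x / 0 = 0 applies. *)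
definition jacobi_poly :: "nat \<Rightarrow> rat \<Rightarrow> rat \<Rightarrow> rat poly" where
  "jacobi_poly n \<alpha> \<beta> =
     (\<Sum>j=0..n. Polynomial.monom
        (of_nat (n choose j) *
         (\<Prod>k=j+1..n. (\<alpha> + of_nat k) / (of_nat n + \<alpha> + \<beta> + of_nat k)) *
         (-1) ^ (n - j)) j)"

definition power_sum :: "nat \<Rightarrow> (nat \<Rightarrow> 'a :: comm_ring_1) \<Rightarrow> nat \<Rightarrow> 'a" where
  "power_sum n \<theta> k = (\<Sum>j=1..n. \<theta> j ^ k)"

definition power_sum_det :: "nat \<Rightarrow> (nat \<Rightarrow> 'a :: comm_ring_1) \<Rightarrow> nat \<Rightarrow> 'a" where
  "power_sum_det n \<theta> t = det (mat t t (\<lambda>(i, j). power_sum n \<theta> (i + j)))"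

(* The truncated subtractions on nat below are exact for 1 <= t <= n. *)

definition A_coeff :: "nat \<Rightarrow> nat \<Rightarrow> rat" where
  "A_coeff n t = (\<Prod>j=n-t+1..n. of_nat j ^ (j - (n - t)))"

definition B_coeff :: "nat \<Rightarrow> rat \<Rightarrow> rat \<Rightarrow> nat \<Rightarrow> rat" where
  "B_coeff n \<alpha> \<beta> t =
     (\<Prod>j=n-t+2..n.
        ((\<alpha> + of_nat j) * (\<beta> + of_nat j)) ^ (j - (n - t + 1)) *
        (\<alpha> + \<beta> + of_nat j) ^ (j - (n - t + 2)))"

definition C_coeff :: "nat \<Rightarrow> rat \<Rightarrow> rat \<Rightarrow> nat \<Rightarrow> rat" where
  "C_coeff n \<alpha> \<beta> t =
     (\<Prod>j=2*n-2*t+2..2*n. (\<alpha> + \<beta> + of_nat j) ^ (j - (2*n - 2*t + 2)))"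

end

theory Submission
  imports Defs
begin

text \<open>
  Euclid's algorithm on \<open>P = J_n^(\<alpha>,\<beta>)\<close> and \<open>P'\<close> yields monic \<open>Q_k\<close> of degree \<open>k\<close> with
  \<open>Q_k P' = W_k P + R_k\<close> and \<open>deg R_k \<le> n - 1 - k\<close>. Since \<open>P' / P\<close> generates the power sums, the
  \<open>Q_k\<close> are orthogonal for the functional \<open>f \<mapsto> f(\<theta>_1) + \<dots> + f(\<theta>_n)\<close>, so the Hankel determinant is
  the product of the coefficients of \<open>x^(n-1-k)\<close> in \<open>R_k\<close>, for \<open>k < t\<close>. Because \<open>P'\<close> is a multiple of
  \<open>J_{n-1}^(\<alpha>+1,\<beta>+1)\<close>, the \<open>R_k\<close> are multiples of \<open>J_{n-1-k}^(\<alpha>+1,\<beta>+1)\<close>, generated by the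
  three-term recurrence of that family. Only the denominators excluded by the hypotheses
  occur if the \<open>R_k\<close> are written with polynomials whose coefficients are cleared of denominators.
\<close>

hide_const (open) Polynomials.degree

section \<open>Jacobi polynomials cleared of denominators, and relations between their
  coefficients\<close>

text \<open>Clearing denominators in \<open>J_m^(\<alpha>,\<beta>)\<close> gives \<open>hyp_poly p q m\<close> with \<open>p = \<alpha>\<close> and
  \<open>q = m + \<alpha> + \<beta>\<close>; the factors \<open>\<alpha> + k\<close> sit in \<open>hyp_weight\<close>.\<close>

definition hyp_weight :: "'a::field_char_0 \<Rightarrow> nat \<Rightarrow> nat \<Rightarrow> 'a" where
  "hyp_weight p m j = (-1) ^ (m - j) * of_nat (m choose j) * pochhammer (p + of_nat j + 1) (m - j)"

definition hyp_poly :: "'a::field_char_0 \<Rightarrow> 'a \<Rightarrow> nat \<Rightarrow> 'a poly" where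
  "hyp_poly p q m = (\<Sum>j\<le>m. Polynomial.monom (hyp_weight p m j * pochhammer (q + 1) j) j)"

lemma hyp_weight_eq_0: "m < j \<Longrightarrow> hyp_weight p m j = 0"
  by (simp add: hyp_weight_def)

lemma coeff_hyp_poly: "coeff (hyp_poly p q m) j = hyp_weight p m j * pochhammer (q + 1) j"
  by (auto simp: hyp_poly_def coeff_sum hyp_weight_eq_0)

lemma degree_hyp_poly_le: "degree (hyp_poly p q m) \<le> m"
  by (intro degree_le) (auto simp: coeff_hyp_poly hyp_weight_eq_0)

text \<open>The last factor of the longer Pochhammer symbol is \<open>p + m + 1\<close>; binomial
  absorption does the rest. This relation and the next three are kept free of division, so they hold
  for every \<open>p\<close> and every index, also beyond the degree.\<close>

lemma hyp_weight_Suc_degree: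
  "of_nat (Suc m) * (of_nat (Suc m) + p) * hyp_weight p m j =
   (of_nat j - of_nat (Suc m)) * hyp_weight p (Suc m) j"
proof (cases "j \<le> m")
  case True
  then obtain d where m: "m = j + d" using le_Suc_ex by blast
  have b: "of_nat (Suc m) * (of_nat (m choose j) :: 'a) = of_nat (Suc d) * of_nat (Suc m choose j)"
  proof -
    have "Suc m * (m choose j) = Suc d * (Suc m choose j)"
      using binomial_absorb_comp[of "Suc m" j] by (simp add: m del: binomial_Suc_Suc)
    then show ?thesis by (metis of_nat_mult)
  qed
  have "(of_nat (Suc m) * of_nat (m choose j)) * (of_nat (Suc m) + p) * ((-1)^d * pochhammer (p + of_nat j + 1) d)
     = (of_nat (Suc d) * of_nat (Suc m choose j)) * (of_nat (Suc m) + p) * ((-1)^d * pochhammer (p + of_nat j + 1) d)"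
    unfolding b ..
  moreover have "Suc m - j = Suc d" "m - j = d" by (simp_all add: m)
  moreover have "of_nat j - of_nat (Suc m) = - (of_nat (Suc d) :: 'a)" by (simp add: m)
  moreover have "pochhammer (p + of_nat j + 1) (Suc d) = pochhammer (p + of_nat j + 1) d * (of_nat (Suc m) + p)"
    by (simp add: pochhammer_Suc m algebra_simps)
  ultimately show ?thesis
    unfolding hyp_weight_def by (simp add: mult_ac del: of_nat_Suc binomial_Suc_Suc)
next
  case False
  then show ?thesis by (cases "j = Suc m") (simp_all add: hyp_weight_eq_0)
qed

text \<open>The part of the hypergeometric term ratio that does not involve \<open>q\<close>; the
  factor \<open>m - j\<close> is what terminates the series.\<close>

lemma hyp_weight_Suc_index:
  "(of_nat m - of_nat j) * hyp_weight p m j =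
   - (of_nat (Suc j) * (p + of_nat (Suc j)) * hyp_weight p m (Suc j))"
proof (cases "j < m")
  case True
  then obtain d where m: "m = Suc (j + d)" using less_imp_Suc_add by blast
  have b: "of_nat (Suc d) * (of_nat (m choose j) :: 'a) = of_nat (Suc j) * of_nat (m choose Suc j)"
  proof -
    have "Suc d * (m choose j) = Suc j * (m choose Suc j)"
      using binomial_absorption[of j m] binomial_absorb_comp[of m j]
      by (simp add: m del: binomial_Suc_Suc)
    then show ?thesis by (metis of_nat_mult)
  qed
  have "(of_nat (Suc d) * of_nat (m choose j)) * (p + of_nat (Suc j)) * ((-1)^d * pochhammer (p + of_nat (Suc j) + 1) d)
     = (of_nat (Suc j) * of_nat (m choose Suc j)) * (p + of_nat (Suc j)) * ((-1)^d * pochhammer (p + of_nat (Suc j) + 1) d)"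
    unfolding b ..
  moreover have "m - j = Suc d" "m - Suc j = d" by (simp_all add: m)
  moreover have "of_nat m - of_nat j = (of_nat (Suc d) :: 'a)" by (simp add: m)
  moreover have "pochhammer (p + of_nat j + 1) (Suc d) = (p + of_nat (Suc j)) * pochhammer (p + of_nat (Suc j) + 1) d"
    by (simp add: pochhammer_rec algebra_simps)
  ultimately show ?thesis
    unfolding hyp_weight_def by (simp add: mult_ac del: of_nat_Suc binomial_Suc_Suc)
next
  case False
  then show ?thesis by (cases "j = m") (simp_all add: hyp_weight_eq_0)
qed

lemma hyp_weight_shift_param:
  "(of_nat j - of_nat (Suc m)) * hyp_weight p (Suc m) j =
   of_nat (Suc m) * (p + of_nat (Suc j)) * hyp_weight (p + 1) m j"
proof (cases "j \<le> m")
  case True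
  then obtain d where m: "m = j + d" using le_Suc_ex by blast
  have b: "of_nat (Suc d) * of_nat (Suc m choose j) = of_nat (Suc m) * (of_nat (m choose j) :: 'a)"
  proof -
    have "Suc m * (m choose j) = Suc d * (Suc m choose j)"
      using binomial_absorb_comp[of "Suc m" j] by (simp add: m del: binomial_Suc_Suc)
    then show ?thesis by (metis of_nat_mult)
  qed
  have "(of_nat (Suc d) * of_nat (Suc m choose j)) * (p + of_nat (Suc j)) * ((-1)^d * pochhammer (p + 1 + of_nat j + 1) d)
     = (of_nat (Suc m) * of_nat (m choose j)) * (p + of_nat (Suc j)) * ((-1)^d * pochhammer (p + 1 + of_nat j + 1) d)"
    unfolding b ..
  moreover have "Suc m - j = Suc d" "m - j = d" by (simp_all add: m)
  moreover have "of_nat j - of_nat (Suc m) = - (of_nat (Suc d) :: 'a)" by (simp add: m)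
  moreover have "pochhammer (p + of_nat j + 1) (Suc d) = (p + of_nat (Suc j)) * pochhammer (p + 1 + of_nat j + 1) d"
    by (simp add: pochhammer_rec algebra_simps)
  ultimately show ?thesis
    unfolding hyp_weight_def by (simp add: mult_ac del: of_nat_Suc binomial_Suc_Suc)
next
  case False
  then show ?thesis by (cases "j = Suc m") (simp_all add: hyp_weight_eq_0)
qed

text \<open>The effect of differentiation on the weights, used for
  \<open>pderiv_jacobi\<close>.\<close>

lemma hyp_weight_Suc_Suc:
  "of_nat (Suc j) * hyp_weight p (Suc m) (Suc j) = of_nat (Suc m) * hyp_weight (p + 1) m j"
proof -
  have "Suc j * (Suc m choose Suc j) = Suc m * (m choose j)"
    by (rule Suc_times_binomial)
  then have b: "of_nat (Suc j) * (of_nat (Suc m choose Suc j) :: 'a) = of_nat (Suc m) * of_nat (m choose j)"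
    by (metis of_nat_mult)
  define Z where "Z = (-1) ^ (m - j) * pochhammer (p + 1 + of_nat j + 1) (m - j)"
  have p: "p + of_nat (Suc j) + 1 = p + 1 + of_nat j + 1" by simp
  have "of_nat (Suc j) * hyp_weight p (Suc m) (Suc j) = (of_nat (Suc j) * of_nat (Suc m choose Suc j)) * Z"
    unfolding hyp_weight_def diff_Suc_Suc p Z_def by (simp only: mult_ac)
  also have "\<dots> = of_nat (Suc m) * hyp_weight (p + 1) m j"
    unfolding b hyp_weight_def Z_def by (simp only: mult_ac)
  finally show ?thesis .
qed

section \<open>Recurrences for the cleared polynomials\<close>

text \<open>What remains of \<open>hyp_poly_three_term\<close> at the coefficient of index
  \<open>j\<close> once all weights are expressed by a single one, the equation is multiplied by
  \<open>m - j + 1\<close> and common factors are removed.\<close>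

lemma three_term_identity:
  fixes m j p s :: "'a::field_char_0"
  assumes "s + 2 * m + 2 \<noteq> 0" "s + 2 * m + 3 \<noteq> 0" "s + 2 * m + 4 \<noteq> 0"
  shows "(m + s - p + 2) / ((s + 2*m + 2) * (s + 2*m + 3)) * (m - j) * (m - j + 1) * (m + s + 2) =
    j * (p + j)
    - (- m * (p + m) / (s + 2*m + 2) + (m + 1) * (p + m + 1) / (s + 2*m + 4)) * - ((m - j + 1) * (m + s + 2 + j))
    - (m + 1) * (p + m + 1) * (m + s + 2 + j) * (m + s + 3 + j) / ((s + 2*m + 3) * (s + 2*m + 4))"
proof -
  \<comment> \<open>In terms of \<open>D\<close> the denominators are \<open>D\<close>,
    \<open>D + 1\<close> and \<open>D + 2\<close>; substituting for \<open>s\<close> then leaves a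
    polynomial identity.\<close>
  define D where "D = s + 2 * m + 2"
  have s: "s = D - 2 * m - 2" by (simp add: D_def)
  have "D \<noteq> 0" "D + 1 \<noteq> 0" "D + 2 \<noteq> 0"
    using assms by (simp_all add: D_def algebra_simps)
  moreover have "s + 2*m + 2 = D" "s + 2*m + 3 = D + 1" "s + 2*m + 4 = D + 2" by (simp_all add: D_def)
  ultimately show ?thesis
    by (simp add: divide_simps) (simp add: s algebra_simps)
qed

text \<open>At \<open>j = 0\<close> the preceding identity carries the common factor
  \<open>(m + 1) * (s + m + 2)\<close>. Since \<open>s + m + 2\<close> may vanish, the quotient by
  this factor is proved directly.\<close>

lemma three_term_identity_0:
  fixes m p s :: "'a::field_char_0"
  assumes "s + 2 * m + 2 \<noteq> 0" "s + 2 * m + 3 \<noteq> 0" "s + 2 * m + 4 \<noteq> 0"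
  shows "(m + s - p + 2) / ((s + 2*m + 2) * (s + 2*m + 3)) * m =
    (- m * (p + m) / (s + 2*m + 2) + (m + 1) * (p + m + 1) / (s + 2*m + 4))
    - (p + m + 1) * (s + m + 3) * (1 / ((s + 2*m + 3) * (s + 2*m + 4)))"
proof -
  define D where "D = s + 2 * m + 2"
  have s: "s = D - 2 * m - 2" by (simp add: D_def)
  have "D \<noteq> 0" "D + 1 \<noteq> 0" "D + 2 \<noteq> 0"
    using assms by (simp_all add: D_def algebra_simps)
  moreover have "s + 2*m + 2 = D" "s + 2*m + 3 = D + 1" "s + 2*m + 4 = D + 2" by (simp_all add: D_def)
  ultimately show ?thesis
    by (simp add: divide_simps) (simp add: s algebra_simps)
qed

text \<open>The classical three-term recurrence for Jacobi polynomials with parameters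
  \<open>p\<close> and \<open>s + 2 - p\<close>, in degrees \<open>l\<close> to
  \<open>l + 2\<close>. For the cleared polynomials only the three denominators assumed nonzero
  occur. The linear factor is monic, which later keeps the \<open>Q_k\<close> monic.\<close>

lemma hyp_poly_three_term:
  fixes p s :: "'a::field_char_0" and l :: nat
  defines "m \<equiv> of_nat (Suc l)"
  assumes D: "s + 2 * m + 2 \<noteq> 0" "s + 2 * m + 3 \<noteq> 0" "s + 2 * m + 4 \<noteq> 0"
  defines "a \<equiv> - m * (p + m) / (s + 2*m + 2) + (m + 1) * (p + m + 1) / (s + 2*m + 4)"
  shows "smult (m * (m + p) * (m + s - p + 2) / ((s + 2*m + 2) * (s + 2*m + 3))) (hyp_poly p (s + m + 1) l) =
    [:- a, 1:] * hyp_poly p (s + m + 2) (Suc l)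
    - smult ((s + m + 3) / ((s + 2*m + 3) * (s + 2*m + 4))) (hyp_poly p (s + m + 3) (Suc (Suc l)))"
    (is "?L = ?R")
proof (rule poly_eqI)
  fix k
  define w where "w = hyp_weight p (Suc l)"
  define j where "j = (of_nat k :: 'a)"
  define r where "r = (m + s - p + 2) / ((s + 2*m + 2) * (s + 2*m + 3))"
  define e where "e = 1 / ((s + 2*m + 3) * (s + 2*m + 4))"
  define G where "G = pochhammer (s + m + 3) k"
  have w0: "m * (m + p) * hyp_weight p l k = (j - m) * w k"
    using hyp_weight_Suc_degree[of l p k] by (simp add: w_def m_def j_def)
  have w2: "(m + 1) * (p + m + 1) * w k = (j - m - 1) * hyp_weight p (Suc (Suc l)) k"
    using hyp_weight_Suc_degree[of "Suc l" p k] by (simp add: w_def m_def j_def algebra_simps)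
  have R: "(s + m + 3) * pochhammer (s + m + 4) k = G * (s + m + 3 + j)"
  proof -
    have "s + m + 4 = s + m + 3 + 1" by simp
    then show ?thesis
      unfolding G_def j_def by (simp only: pochhammer_Suc flip: pochhammer_rec)
  qed
  have one: "s + m + 1 + 1 = s + m + 2" "s + m + 2 + 1 = s + m + 3" "s + m + 3 + 1 = s + m + 4"
    by simp_all
  have "coeff ?L k = r * (m * (m + p) * hyp_weight p l k) * pochhammer (s + m + 2) k"
    unfolding coeff_smult coeff_hyp_poly one r_def by simp
  also have "\<dots> = r * (j - m) * w k * pochhammer (s + m + 2) k"
    by (simp add: w0)
  finally have cL: "coeff ?L k = r * (j - m) * w k * pochhammer (s + m + 2) k" .
  have cR: "coeff ?R k = - a * (w k * G)
      + (case k of 0 \<Rightarrow> 0 | Suc i \<Rightarrow> w i * pochhammer (s + m + 3) i)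
      - e * (hyp_weight p (Suc (Suc l)) k * (G * (s + m + 3 + j)))"
    unfolding R[symmetric] by (simp add: coeff_hyp_poly one coeff_pCons w_def G_def e_def mult_ac split: nat.split)
  have core: "r * (m - j) * (m - j + 1) * (m + s + 2) =
    j * (p + j) - a * - ((m - j + 1) * (m + s + 2 + j))
    - (m + 1) * (p + m + 1) * (m + s + 2 + j) * (m + s + 3 + j) * e"
    using three_term_identity[OF D, of p j] by (simp add: r_def a_def e_def)
  show "coeff ?L k = coeff ?R k"
  proof (cases k)
    \<comment> \<open>The multiplication by \<open>x\<close> contributes nothing to the constant
      coefficient, and cancelling \<open>m + 1\<close> expresses the weight of degree
      \<open>l + 2\<close> by \<open>w k\<close>.\<close>
    case 0
    then have [simp]: "j = 0" "G = 1" by (simp_all add: j_def G_def)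
    have "(m + 1) * hyp_weight p (Suc (Suc l)) k = - ((j - m - 1) * hyp_weight p (Suc (Suc l)) k)"
      by (simp add: algebra_simps)
    also have "\<dots> = (m + 1) * (- (p + m + 1) * w k)"
      by (simp only: w2[symmetric] mult_minus_left mult_minus_right mult.assoc)
    finally have "(m + 1) * hyp_weight p (Suc (Suc l)) k = (m + 1) * (- (p + m + 1) * w k)" .
    moreover have "m + 1 = of_nat (Suc (Suc l))" by (simp add: m_def)
    then have "m + 1 \<noteq> 0" by (simp only: of_nat_neq_0 not_False_eq_True)
    ultimately have v: "hyp_weight p (Suc (Suc l)) k = - (p + m + 1) * w k" by simp
    have core0: "r * m = a - (p + m + 1) * (s + m + 3) * e"
      unfolding r_def a_def e_def by (rule three_term_identity_0[OF D])
    have "coeff ?L k = - (r * m) * w k" unfolding cL by (simp add: 0)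
    also have "\<dots> = coeff ?R k" unfolding cR v core0 by (simp add: 0 algebra_simps)
    finally show ?thesis .
  next
    case (Suc i)
    define Y where "Y = pochhammer (s + m + 3) i"
    have G: "G = Y * (s + m + 2 + j)"
      by (simp add: G_def Y_def Suc j_def pochhammer_Suc algebra_simps)
    have Z: "pochhammer (s + m + 2) k = (s + m + 2) * Y"
      by (simp add: Y_def Suc pochhammer_rec algebra_simps)
    have wi: "(m - j + 1) * w i = - (j * (p + j) * w k)"
      using hyp_weight_Suc_index[of "Suc l" i p] by (simp add: w_def m_def j_def Suc algebra_simps)
    show ?thesis
    \<comment> \<open>The relation \<open>wi\<close> determines \<open>w i\<close> from
      \<open>w k\<close> only if \<open>m - j + 1\<close> is nonzero. It vanishes exactly at the top
      index \<open>k = l + 2\<close>, where the coefficients are compared directly.\<close>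
    proof (cases "m - j + 1 = 0")
      case False
      have "(m - j + 1) * coeff ?L k = - (r * (m - j) * (m - j + 1) * (m + s + 2)) * (w k * Y)"
        unfolding cL Z by (simp add: algebra_simps)
      also have "\<dots> = - a * ((m - j + 1) * w k * G) + - (j * (p + j) * w k) * Y
         + e * (((m + 1) * (p + m + 1) * w k) * (G * (s + m + 3 + j)))"
        unfolding core G by (simp add: algebra_simps)
      also have "\<dots> = (m - j + 1) * coeff ?R k"
        unfolding cR w2 wi[symmetric] by (simp add: Suc Y_def algebra_simps)
      finally show ?thesis using mult_left_cancel[OF False] by blast
    next
      case True
      then have j: "j = m + 1" by (simp add: algebra_simps)
      then have "of_nat k = (of_nat (Suc (Suc l)) :: 'a)" by (simp add: j_def m_def)
      then have k: "k = Suc (Suc l)" using of_nat_eq_iff by blast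
      have f: "w k = 0" "w i = 1" "hyp_weight p (Suc (Suc l)) k = 1"
        using Suc k by (simp_all add: w_def hyp_weight_def)
      have cs: "(case k of 0 \<Rightarrow> 0 | Suc i \<Rightarrow> w i * pochhammer (s + m + 3) i) = Y"
        by (simp add: Suc Y_def f(2))
      have "s + m + 2 + j = s + 2 * m + 3" "s + m + 3 + j = s + 2 * m + 4" by (simp_all add: j)
      then have "(s + m + 2 + j) * (s + m + 3 + j) * e = (s + 2 * m + 3) * (s + 2 * m + 4) * e"
        by (simp only:)
      also have "\<dots> = 1" using D by (simp add: e_def)
      finally have "(s + m + 2 + j) * (s + m + 3 + j) * e = 1" .
      moreover have "e * (1 * (G * (s + m + 3 + j))) = Y * ((s + m + 2 + j) * (s + m + 3 + j) * e)"
        unfolding G by (simp add: mult_ac)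
      ultimately show ?thesis unfolding cL cR cs f(1,3) by simp
    qed
  qed
qed

text \<open>The first division step in cleared form: the polynomial of degree \<open>n\<close> with
  parameters \<open>p\<close>, \<open>b\<close> against those of degrees \<open>n - 1\<close> and
  \<open>n - 2\<close> with parameters \<open>p + 1\<close>, \<open>b + 1\<close>. The factor
  \<open>p + b + n + 1\<close> stays on the right, so \<open>p + b + 2 * n\<close> is the only
  denominator.\<close>

lemma hyp_poly_contiguous:
  fixes p b :: "'a::field_char_0" and l :: nat
  defines "n \<equiv> of_nat (Suc (Suc l))"
  assumes D: "p + b + 2 * n \<noteq> 0"
  shows "smult ((n - 1) * (n + p) * (n + b) / (p + b + 2 * n)) (hyp_poly (p + 1) (p + b + n) l) =
    smult (p + b + n + 1) ([:- ((p + n) / (p + b + 2 * n)), 1:] * hyp_poly (p + 1) (p + b + n + 1) (Suc l))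
    - hyp_poly p (p + b + n) (Suc (Suc l))"
    (is "?L = ?R")
proof (rule poly_eqI)
  fix k
  define w where "w = hyp_weight (p + 1) (Suc l)"
  define j where "j = (of_nat k :: 'a)"
  define q where "q = p + b + n"
  define G where "G = pochhammer (q + 1) k"
  have w0: "(n - 1) * (n + p) * hyp_weight (p + 1) l k = (j - n + 1) * w k"
    using hyp_weight_Suc_degree[of l "p + 1" k] by (simp add: w_def n_def j_def algebra_simps)
  have w2: "(j - n) * hyp_weight p (Suc (Suc l)) k = n * (p + j + 1) * w k"
    using hyp_weight_shift_param[of k "Suc l" p] by (simp add: w_def n_def j_def algebra_simps)
  have R: "(q + 1) * pochhammer (q + 2) k = G * (q + 1 + j)"
  proof -
    have "q + 2 = q + 1 + 1" by simp
    then show ?thesis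
      unfolding G_def j_def by (simp only: pochhammer_Suc flip: pochhammer_rec)
  qed
  define c where "c = (p + n) / (p + b + 2 * n)"
  have one: "p + b + n + 1 = q + 1" "q + 1 + 1 = q + 2" by (simp_all add: q_def)
  have "coeff ?L k = ((n - 1) * (n + p) * hyp_weight (p + 1) l k) * (n + b) / (p + b + 2 * n) * G"
    by (simp add: coeff_hyp_poly G_def q_def mult_ac)
  also have "\<dots> = (j - n + 1) * (n + b) / (p + b + 2 * n) * (w k * G)"
    by (simp add: w0)
  finally have cL: "coeff ?L k = (j - n + 1) * (n + b) / (p + b + 2 * n) * (w k * G)" .
  have Y: "(case k of 0 \<Rightarrow> 0 | Suc i \<Rightarrow> w i * ((q + 1) * pochhammer (q + 2) i)) =
      (case k of 0 \<Rightarrow> 0 | Suc i \<Rightarrow> w i * G)"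
    by (simp add: G_def pochhammer_rec add.assoc split: nat.split)
  have "coeff ?R k = - c * (w k * ((q + 1) * pochhammer (q + 2) k))
      + (case k of 0 \<Rightarrow> 0 | Suc i \<Rightarrow> w i * ((q + 1) * pochhammer (q + 2) i))
      - hyp_weight p (Suc (Suc l)) k * G"
    unfolding one c_def[symmetric] q_def[symmetric]
    by (simp add: coeff_hyp_poly one coeff_pCons w_def G_def right_diff_distrib mult_ac split: nat.split)
  then have cR: "coeff ?R k = - c * (w k * (G * (q + 1 + j)))
      + (case k of 0 \<Rightarrow> 0 | Suc i \<Rightarrow> w i) * G - hyp_weight p (Suc (Suc l)) k * G"
    unfolding R Y by (simp split: nat.split)
  \<comment> \<open>A Pascal-type rule. The relations for the two weights combine to it only up to
    the factor \<open>j - n\<close>, so the top index, where this factor vanishes, is checked by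
    hand.\<close>
  have v: "hyp_weight p (Suc (Suc l)) k - (case k of 0 \<Rightarrow> 0 | Suc i \<Rightarrow> w i) = - (p + j + 1) * w k"
  proof (cases k)
    case 0
    have n: "n \<noteq> 0" unfolding n_def of_nat_eq_0_iff by simp
    have "n * hyp_weight p (Suc (Suc l)) k = - ((j - n) * hyp_weight p (Suc (Suc l)) k)"
      by (simp add: 0 j_def)
    also have "\<dots> = n * (- (p + j + 1) * w k)"
      by (simp only: w2 mult_minus_left mult_minus_right mult.assoc)
    finally have "hyp_weight p (Suc (Suc l)) k = - (p + j + 1) * w k" using n by (metis mult_left_cancel)
    with 0 show ?thesis by simp
  next
    case (Suc i)
    have wi: "(n - j) * w i = - (j * (p + j + 1) * w k)"
      using hyp_weight_Suc_index[of "Suc l" i "p + 1"]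
      by (simp add: w_def n_def j_def Suc algebra_simps)
    show ?thesis
    proof (cases "n = j")
      case False
      have "(j - n) * (hyp_weight p (Suc (Suc l)) k - w i) = n * (p + j + 1) * w k - j * (p + j + 1) * w k"
        using w2 wi by (simp add: algebra_simps)
      also have "\<dots> = (j - n) * (- (p + j + 1) * w k)" by (simp add: algebra_simps)
      finally show ?thesis using False by (simp add: Suc)
    next
      case True
      then have "k = Suc (Suc l)" by (simp only: n_def j_def of_nat_eq_iff)
      with Suc show ?thesis by (simp add: w_def hyp_weight_def)
    qed
  qed
  have core: "(j - n + 1) * (n + b) / (p + b + 2 * n) =
      (p + j + 1) - c * (q + 1 + j)"
    using D by (simp add: q_def c_def divide_simps) (simp add: algebra_simps)
  have "coeff ?R k = - c * (w k * (G * (q + 1 + j)))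
      - (hyp_weight p (Suc (Suc l)) k - (case k of 0 \<Rightarrow> 0 | Suc i \<Rightarrow> w i)) * G"
    unfolding cR by (simp add: left_diff_distrib)
  also have "\<dots> = ((p + j + 1) - c * (q + 1 + j)) * (w k * G)"
    unfolding v by (simp add: algebra_simps)
  also have "\<dots> = coeff ?L k" unfolding cL core ..
  finally show "coeff ?L k = coeff ?R k" ..
qed

section \<open>Power sums as coefficients of remainders, and triangularisation of Hankel
  matrices\<close>

text \<open>Dividing \<open>f P'\<close> by \<open>P\<close>, the coefficient of \<open>x^(n-1)\<close> in the remainder is the
  residue at infinity of \<open>f P' / P\<close>; this reads off power sums without inverting \<open>P\<close>.\<close>

lemma sum_poly_eq_coeff_remainder:
  fixes \<theta> :: "'b \<Rightarrow> 'a::field"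
  assumes J: "finite J" and P: "P = (\<Prod>j\<in>J. [:- \<theta> j, 1:])"
    and div: "f * pderiv P = V * P + S" and deg: "degree S < card J"
  shows "(\<Sum>j\<in>J. poly f (\<theta> j)) = coeff S (card J - 1)"
proof -
  define C where "C j = (\<Prod>i\<in>J - {j}. [:- \<theta> i, 1:])" for j
  define T where "T = (\<Sum>j\<in>J. smult (poly f (\<theta> j)) (C j))"
  define W where "W = (\<Sum>j\<in>J. synthetic_div f (\<theta> j))"
  have PC: "P = [:- \<theta> j, 1:] * C j" if "j \<in> J" for j
    unfolding P C_def using J that by (rule prod.remove)
  have degC: "degree (C j) = card J - 1" and leadC: "coeff (C j) (card J - 1) = 1" if "j \<in> J" for j
  proof -
    show d: "degree (C j) = card J - 1"
      unfolding C_def using J that by (subst degree_prod_eq_sum_degree) auto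
    have "lead_coeff (C j) = 1"
      unfolding C_def by (subst lead_coeff_prod) simp
    then show "coeff (C j) (card J - 1) = 1" by (simp add: d)
  qed
  \<comment> \<open>Product rule, \<open>C j\<close> being the product without the factor of index
    \<open>j\<close>. Dividing \<open>f\<close> by each linear factor separately works for repeated
    roots as well.\<close>
  have "f * pderiv P = (\<Sum>j\<in>J. f * C j)"
    unfolding P pderiv_prod by (simp add: sum_distrib_left C_def pderiv_pCons)
  also have "\<dots> = (\<Sum>j\<in>J. smult (poly f (\<theta> j)) (C j) + synthetic_div f (\<theta> j) * P)"
  proof (rule sum.cong)
    fix j assume j: "j \<in> J"
    have "f * C j = ([:- \<theta> j, 1:] * synthetic_div f (\<theta> j) + [:poly f (\<theta> j):]) * C j"
      by (simp only: synthetic_div_correct')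
    then show "f * C j = smult (poly f (\<theta> j)) (C j) + synthetic_div f (\<theta> j) * P"
      unfolding PC[OF j] by (simp add: algebra_simps)
  qed simp
  also have "\<dots> = W * P + T"
    by (simp add: W_def T_def sum.distrib sum_distrib_right)
  finally have eq: "(V - W) * P = T - S" using div by (simp add: algebra_simps)
  \<comment> \<open>\<open>S\<close> and \<open>T\<close> are both remainders of
    \<open>f * pderiv P\<close> modulo \<open>P\<close> of degree below \<open>card J\<close>, hence
    equal. The coefficient of \<open>T\<close> is the required sum because every \<open>C j\<close>
    is monic of degree \<open>card J - 1\<close>.\<close>
  have "S = T"
  proof (cases "V = W")
    case False
    have degP: "degree P = card J"
      unfolding P by (subst degree_prod_eq_sum_degree) auto
    have "card J > 0" using deg by simp
    moreover have "degree T \<le> card J - 1"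
      unfolding T_def by (intro degree_sum_le J order.trans[OF degree_smult_le]) (simp add: degC)
    ultimately have "degree (T - S) < card J"
      using deg by (intro degree_diff_less) auto
    moreover have "P \<noteq> 0" using degP \<open>card J > 0\<close> by auto
    then have "degree ((V - W) * P) \<ge> card J"
      using False by (simp add: degree_mult_eq degP)
    ultimately show ?thesis unfolding eq by simp
  qed (use eq in simp)
  then show ?thesis
    using leadC by (simp add: T_def coeff_sum)
qed

text \<open>The columns of \<open>U\<close> hold the coefficients of the monic \<open>Q k\<close>,
  so \<open>U\<close> is upper triangular with unit diagonal and determinant 1. Orthogonality makes
  \<open>H * U\<close> lower triangular with diagonal \<open>h\<close>.\<close>

lemma det_hankel_eq_prod:
  fixes s :: "nat \<Rightarrow> 'a::idom"
  assumes deg: "\<And>k. k < t \<Longrightarrow> degree (Q k) \<le> k" and monic: "\<And>k. k < t \<Longrightarrow> coeff (Q k) k = 1"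
    and orth: "\<And>i k. i < k \<Longrightarrow> k < t \<Longrightarrow> (\<Sum>l\<le>k. coeff (Q k) l * s (i + l)) = 0"
    and diag: "\<And>k. k < t \<Longrightarrow> (\<Sum>l\<le>k. coeff (Q k) l * s (k + l)) = h k"
  shows "det (mat t t (\<lambda>(i, j). s (i + j))) = (\<Prod>k<t. h k)"
proof -
  define H where "H = mat t t (\<lambda>(i, j). s (i + j))"
  define U where "U = mat t t (\<lambda>(l, k). coeff (Q k) l)"
  have HU: "(H * U) $$ (i, k) = (\<Sum>l\<le>k. coeff (Q k) l * s (i + l))" if "i < t" "k < t" for i k
  proof -
    have "(H * U) $$ (i, k) = (\<Sum>l\<in>{0..<t}. coeff (Q k) l * s (i + l))"
      using that by (simp add: H_def U_def scalar_prod_def mult.commute)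
    also have "\<dots> = (\<Sum>l\<le>k. coeff (Q k) l * s (i + l))"
      using that deg[of k] by (intro sum.mono_neutral_right) (auto intro: coeff_eq_0)
    finally show ?thesis .
  qed
  have carr: "H \<in> carrier_mat t t" "U \<in> carrier_mat t t" by (simp_all add: H_def U_def)
  have "det U = (\<Prod>k\<in>{0..<t}. U $$ (k, k))"
    using carr(2)
    by (subst det_upper_triangular[of _ t])
      (auto simp: prod_list_diag_prod U_def intro!: upper_triangularI coeff_eq_0 le_less_trans[OF deg])
  also have "\<dots> = 1" by (simp add: U_def monic)
  finally have "det U = 1" .
  moreover have "det (H * U) = (\<Prod>k\<in>{0..<t}. (H * U) $$ (k, k))"
    using carr
    by (subst det_lower_triangular[of t])
      (auto simp: prod_list_diag_prod HU orth simp del: index_mult_mat(1))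
  moreover have "(\<Prod>k\<in>{0..<t}. (H * U) $$ (k, k)) = (\<Prod>k<t. h k)"
    by (simp add: HU diag atLeast0LessThan)
  ultimately show ?thesis using det_mult[OF carr] by (simp add: H_def)
qed

section \<open>Euclidean remainders of the Jacobi polynomial and its derivative\<close>

text \<open>The first step is exceptional because \<open>J_n^(\<alpha>,\<beta>)\<close> does not belong to the family with
  parameters \<open>\<alpha> + 1, \<beta> + 1\<close>; the recurrence of that family would also need \<open>\<alpha> + \<beta> + 2n + 1 \<noteq> 0\<close>
  there.\<close>

fun jacobi_scale :: "nat \<Rightarrow> 'a::field_char_0 \<Rightarrow> 'a \<Rightarrow> nat \<Rightarrow> 'a" where
  "jacobi_scale n a b 0 = of_nat n / pochhammer (a + b + of_nat n + 2) (n - 1)"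
| "jacobi_scale n a b (Suc 0) = jacobi_scale n a b 0 *
    ((of_nat n - 1) * (of_nat n + a) * (of_nat n + b) / ((a + b + 2 * of_nat n) * (a + b + of_nat n + 1)))"
| "jacobi_scale n a b (Suc (Suc k)) = jacobi_scale n a b (Suc k) *
    (let m = of_nat (n - 2 - k) in
      m * (m + a + 1) * (m + b + 1) / ((a + b + 2 * m + 2) * (a + b + 2 * m + 3)))"

text \<open>The remainder \<open>R_k\<close>. The second argument of \<open>hyp_poly\<close> is the
  degree \<open>n - 1 - k\<close> plus the sum of the parameters \<open>a + 1\<close> and
  \<open>b + 1\<close>.\<close>

definition jacobi_rem :: "nat \<Rightarrow> 'a::field_char_0 \<Rightarrow> 'a \<Rightarrow> nat \<Rightarrow> 'a poly" where
  "jacobi_rem n a b k = smult (jacobi_scale n a b k)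
     (hyp_poly (a + 1) (a + b + of_nat (n - 1 - k) + 2) (n - 1 - k))"

text \<open>The coefficient of \<open>x^(n-1-k)\<close> in \<open>R_k\<close>. It can be zero, for
  instance if \<open>a = -n\<close> and \<open>k = 1\<close>, so it need not be the
  \<open>lead_coeff\<close>.\<close>

definition jacobi_lead :: "nat \<Rightarrow> 'a::field_char_0 \<Rightarrow> 'a \<Rightarrow> nat \<Rightarrow> 'a" where
  "jacobi_lead n a b k =
     jacobi_scale n a b k * pochhammer (a + b + of_nat (n - 1 - k) + 3) (n - 1 - k)"

text \<open>The counterpart of \<open>jacobi_poly\<close> over any field of characteristic 0,
  written with one common denominator, so that it is available over the algebraic closure.\<close>

definition jacobi :: "nat \<Rightarrow> 'a::field_char_0 \<Rightarrow> 'a \<Rightarrow> 'a poly" where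
  "jacobi n a b = smult (1 / pochhammer (a + b + of_nat n + 1) n) (hyp_poly a (a + b + of_nat n) n)"

lemma degree_jacobi_rem_le: "degree (jacobi_rem n a b k) \<le> n - 1 - k"
  unfolding jacobi_rem_def by (rule order.trans[OF degree_smult_le degree_hyp_poly_le])

lemma coeff_jacobi_rem_top: "coeff (jacobi_rem n a b k) (n - 1 - k) = jacobi_lead n a b k"
  by (simp add: jacobi_rem_def jacobi_lead_def coeff_hyp_poly hyp_weight_def add.assoc)

text \<open>Differentiation lowers the degree by one and raises both parameters by one. The factor
  \<open>a + b + n + 1\<close> cancels between the Pochhammer symbols, which yields the initial
  value of \<open>jacobi_scale\<close>.\<close>

lemma pderiv_jacobi:
  assumes "n \<ge> 1" and "a + b + of_nat n + 1 \<noteq> 0"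
  shows "pderiv (jacobi n a b) = jacobi_rem n a b 0"
proof (rule poly_eqI)
  fix j
  obtain l where n: "n = Suc l" using assms(1) by (cases n) auto
  define q where "q = a + b + of_nat n"
  have q: "q + 1 \<noteq> 0" using assms(2) by (simp add: q_def)
  have q2: "a + b + of_nat n + 2 = q + 1 + 1" "a + b + of_nat (n - 1) + 2 + 1 = q + 1 + 1"
    by (simp_all add: q_def n)
  have "coeff (pderiv (jacobi n a b)) j = 1 / pochhammer (q + 1) n *
      (of_nat (Suc j) * hyp_weight a (Suc l) (Suc j)) * pochhammer (q + 1) (Suc j)"
    unfolding q_def by (simp add: coeff_pderiv jacobi_def coeff_hyp_poly n mult_ac del: of_nat_Suc)
  also have "\<dots> = of_nat n * hyp_weight (a + 1) l j * (pochhammer (q + 1) (Suc j) / pochhammer (q + 1) (Suc l))"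
    unfolding hyp_weight_Suc_Suc by (simp add: n)
  also have "\<dots> = of_nat n * hyp_weight (a + 1) l j *
      (pochhammer (q + 1 + 1) j / pochhammer (q + 1 + 1) l)"
    using q by (simp add: pochhammer_rec)
  also have "\<dots> = coeff (jacobi_rem n a b 0) j"
    unfolding jacobi_rem_def coeff_smult coeff_hyp_poly jacobi_scale.simps q2 minus_nat.diff_0
    by (simp add: n)
  finally show "coeff (pderiv (jacobi n a b)) j = coeff (jacobi_rem n a b 0) j" .
qed

text \<open>Only the existence of the factor matters: it enters the recurrence of the remainders
  through the unspecified coefficient \<open>v\<close>.\<close>

lemma jacobi_scale_Suc_factor: "\<exists>c. jacobi_scale n a b (Suc k) = jacobi_scale n a b k * c"
  by (cases k) (metis jacobi_scale.simps(2), metis jacobi_scale.simps(3))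

lemma jacobi_rem_1:
  fixes a b :: "'a::field_char_0"
  assumes n: "n \<ge> 2" and nz: "a + b + of_nat n + 1 \<noteq> 0" "a + b + 2 * of_nat n \<noteq> 0"
  shows "[:- ((a + of_nat n) / (a + b + 2 * of_nat n)), 1:] * jacobi_rem n a b 0 =
    [:of_nat n:] * jacobi n a b + jacobi_rem n a b (Suc 0)"
proof -
  define l where "l = n - 2"
  have l: "n = Suc (Suc l)" using n by (simp add: l_def)
  define q where "q = a + b + of_nat n"
  \<comment> \<open>The common factor of all three terms: \<open>c\<close> times the cleared
    polynomial is \<open>n\<close> times \<open>jacobi n a b\<close>, \<open>c * (q + 1)\<close> is
    the scale of \<open>R_0\<close> and \<open>c * d\<close> that of \<open>R_1\<close>. The claim
    is thus \<open>c\<close> times \<open>hyp_poly_contiguous\<close>.\<close>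
  define c where "c = of_nat n / pochhammer (q + 1) n"
  define A where "A = hyp_poly (a + 1) (q + 1) (Suc l)"
  define G where "G = [:- ((a + of_nat n) / (a + b + 2 * of_nat n)), 1:]"
  define d where "d = (of_nat n - 1) * (of_nat n + a) * (of_nat n + b) / (a + b + 2 * of_nat n)"
  have q1: "q + 1 \<noteq> 0" using nz by (simp add: q_def)
  have q2: "q + 2 = q + 1 + 1" by simp
  have c: "c * (q + 1) = of_nat n / pochhammer (q + 2) (n - 1)"
    using q1 unfolding c_def q2 by (simp add: l pochhammer_rec del: of_nat_Suc)
  have R0: "jacobi_rem n a b 0 = smult (c * (q + 1)) A"
    unfolding c by (simp add: jacobi_rem_def A_def l q_def algebra_simps)
  have "jacobi_scale n a b (Suc 0) = c * (q + 1) * (d / (q + 1))"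
    unfolding c by (simp add: d_def q_def)
  then have sc: "jacobi_scale n a b (Suc 0) = c * d" using q1 by simp
  have R1: "jacobi_rem n a b (Suc 0) = smult (c * d) (hyp_poly (a + 1) q l)"
    unfolding jacobi_rem_def sc by (simp add: l q_def algebra_simps)
  have "smult d (hyp_poly (a + 1) q l) = smult (q + 1) (G * A) - hyp_poly a q n"
    using hyp_poly_contiguous[of a b l] nz(2) unfolding l d_def q_def G_def A_def by simp
  then have "smult c (smult d (hyp_poly (a + 1) q l)) = smult c (smult (q + 1) (G * A) - hyp_poly a q n)"
    by simp
  moreover have "[:of_nat n:] * jacobi n a b = smult c (hyp_poly a q n)"
    by (simp add: jacobi_def c_def q_def)
  ultimately show ?thesis
    unfolding R0 R1 G_def[symmetric] by (simp add: smult_diff_right)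
qed

text \<open>The three-term recurrence rescaled by \<open>jacobi_scale\<close>. Only its shape is
  recorded: a monic linear multiple of one remainder minus a constant multiple of the one
  before.\<close>

lemma jacobi_rem_Suc_Suc:
  fixes a b :: "'a::field_char_0"
  assumes k: "k + 2 < n"
    and nz: "\<And>j::nat. 2 * n - 2 * k - 2 \<le> j \<Longrightarrow> j \<le> 2 * n \<Longrightarrow> a + b + of_nat j \<noteq> 0"
  shows "\<exists>u v. jacobi_rem n a b (Suc (Suc k)) =
    [:u, 1:] * jacobi_rem n a b (Suc k) - smult v (jacobi_rem n a b k)"
proof -
  define l where "l = n - k - 3"
  have n: "n = Suc (Suc (Suc (k + l)))" using k by (simp add: l_def)
  define m where "m = (of_nat (Suc l) :: 'a)"
  define s where "s = a + b"
  \<comment> \<open>The denominators are \<open>a + b + j\<close> for three consecutive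
    \<open>j\<close>, starting at \<open>2 * l + 4 = 2 * n - 2 * k - 2\<close>.\<close>
  have D: "s + 2 * m + 2 \<noteq> 0" "s + 2 * m + 3 \<noteq> 0" "s + 2 * m + 4 \<noteq> 0"
    using nz[of "2 * l + 4"] nz[of "2 * l + 5"] nz[of "2 * l + 6"]
    by (simp_all add: n m_def s_def algebra_simps)
  obtain c where c: "jacobi_scale n a b (Suc k) = jacobi_scale n a b k * c"
    using jacobi_scale_Suc_factor by blast
  define u where "u = - (- m * (a + 1 + m) / (s + 2*m + 2) + (m + 1) * (a + 1 + m + 1) / (s + 2*m + 4))"
  define e where "e = (s + m + 3) / ((s + 2*m + 3) * (s + 2*m + 4))"
  define r where "r = m * (m + a + 1) * (m + b + 1) / ((s + 2 * m + 2) * (s + 2 * m + 3))"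
  have r: "m * (m + (a + 1)) * (m + s - (a + 1) + 2) / ((s + 2*m + 2) * (s + 2*m + 3)) = r"
    by (simp add: r_def s_def algebra_simps)
  have F: "smult r (hyp_poly (a + 1) (s + m + 1) l) =
      [:u, 1:] * hyp_poly (a + 1) (s + m + 2) (Suc l) - smult e (hyp_poly (a + 1) (s + m + 3) (Suc (Suc l)))"
    using hyp_poly_three_term[of s l "a + 1"] D
    unfolding m_def[symmetric] r e_def[symmetric] u_def[symmetric] by simp
  have R2: "jacobi_rem n a b (Suc (Suc k)) =
      smult (jacobi_scale n a b (Suc k)) (smult r (hyp_poly (a + 1) (s + m + 1) l))"
    by (simp add: jacobi_rem_def n r_def m_def s_def Let_def algebra_simps)
  have R1: "jacobi_rem n a b (Suc k) = smult (jacobi_scale n a b (Suc k)) (hyp_poly (a + 1) (s + m + 2) (Suc l))"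
    by (simp add: jacobi_rem_def n m_def s_def algebra_simps)
  have R0: "jacobi_rem n a b k = smult (jacobi_scale n a b k) (hyp_poly (a + 1) (s + m + 3) (Suc (Suc l)))"
    by (simp add: jacobi_rem_def n m_def s_def algebra_simps)
  have "jacobi_rem n a b (Suc (Suc k)) = [:u, 1:] * jacobi_rem n a b (Suc k) - smult (c * e) (jacobi_rem n a b k)"
    unfolding R2 F R1 R0 unfolding c by (simp add: smult_diff_right mult_ac)
  then show ?thesis by blast
qed

section \<open>Orthogonality, and the determinant as a product\<close>

text \<open>\<open>Q\<close> and \<open>W\<close> obey the recurrence of the remainders, starting
  from the pairs \<open>1, 0\<close> and \<open>x - (a + n) / (a + b + 2 * n), n\<close>. Each step
  multiplies the last \<open>Q\<close> by a monic linear polynomial and subtracts a term of lower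
  degree, so \<open>Q\<close> stays monic.\<close>

lemma jacobi_convergents:
  fixes a b :: "'a::field_char_0"
  assumes n: "n \<ge> 2" and t: "t \<le> n"
    and nz1: "\<And>j::nat. n + 1 \<le> j \<Longrightarrow> j \<le> 2 * n \<Longrightarrow> a + b + of_nat j \<noteq> 0"
    and nz2: "\<And>j::nat. 2 * n - 2 * t + 3 \<le> j \<Longrightarrow> j \<le> 2 * n \<Longrightarrow> a + b + of_nat j \<noteq> 0"
  shows "k < t \<Longrightarrow> \<exists>Q W. degree Q \<le> k \<and> coeff Q k = 1 \<and>
    Q * pderiv (jacobi n a b) = W * jacobi n a b + jacobi_rem n a b k"
proof (induction k rule: less_induct)
  case (less k)
  have nz: "a + b + of_nat n + 1 \<noteq> 0" "a + b + 2 * of_nat n \<noteq> 0"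
    using nz1[of "n + 1"] nz1[of "2 * n"] n by (simp_all add: algebra_simps)
  have P': "pderiv (jacobi n a b) = jacobi_rem n a b 0"
    using n nz by (intro pderiv_jacobi) auto
  consider "k = 0" | "k = Suc 0" | i where "k = Suc (Suc i)" by (metis not0_implies_Suc)
  then show ?case
  proof cases
    case 1
    then show ?thesis unfolding P' by (intro exI[of _ 1] exI[of _ 0]) simp
  next
    case 2
    then show ?thesis
      unfolding P' using jacobi_rem_1[OF n nz]
      by (intro exI[of _ "[:- ((a + of_nat n) / (a + b + 2 * of_nat n)), 1:]"] exI[of _ "[:of_nat n:]"]) simp
  next
    case 3
    obtain Q0 W0 where Q0: "degree Q0 \<le> i" "Q0 * pderiv (jacobi n a b) = W0 * jacobi n a b + jacobi_rem n a b i"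
      using less.IH[of i] less.prems 3 by auto
    obtain Q1 W1 where Q1: "degree Q1 \<le> Suc i" "coeff Q1 (Suc i) = 1"
      "Q1 * pderiv (jacobi n a b) = W1 * jacobi n a b + jacobi_rem n a b (Suc i)"
      using less.IH[of "Suc i"] less.prems 3 by auto
    obtain u v where uv: "jacobi_rem n a b (Suc (Suc i)) =
        [:u, 1:] * jacobi_rem n a b (Suc i) - smult v (jacobi_rem n a b i)"
      using jacobi_rem_Suc_Suc[of i n a b] nz2 less.prems t 3 by auto
    define U where "U = [:u, 1:]"
    define Q where "Q = U * Q1 - smult v Q0"
    define W where "W = U * W1 - smult v W0"
    have "degree (U * Q1) \<le> degree U + degree Q1" by (rule degree_mult_le)
    then have "degree Q \<le> k"
      unfolding Q_def 3 using Q0(1) Q1(1) degree_smult_le[of v Q0] by (intro degree_diff_le) (auto simp: U_def)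
    moreover have "coeff Q k = 1"
      using Q0(1) Q1 by (simp add: Q_def U_def 3 coeff_eq_0)
    moreover have "Q * pderiv (jacobi n a b) = W * jacobi n a b + jacobi_rem n a b k"
    proof -
      have "Q * pderiv (jacobi n a b) = U * (Q1 * pderiv (jacobi n a b)) - smult v (Q0 * pderiv (jacobi n a b))"
        unfolding Q_def by (simp add: left_diff_distrib mult.assoc)
      also have "\<dots> = W * jacobi n a b + (U * jacobi_rem n a b (Suc i) - smult v (jacobi_rem n a b i))"
        unfolding Q0(2) Q1(3) W_def by (simp add: left_diff_distrib distrib_left mult.assoc smult_add_right)
      also have "U * jacobi_rem n a b (Suc i) - smult v (jacobi_rem n a b i) = jacobi_rem n a b k"
        unfolding 3 uv U_def ..
      finally show ?thesis .
    qed
    ultimately show ?thesis by blast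
  qed
qed

text \<open>Identifies the sums in \<open>det_hankel_eq_prod\<close> with the values of the
  power-sum functional at \<open>x^i * Q\<close>.\<close>

lemma sum_poly_monom_mult:
  fixes \<theta> :: "nat \<Rightarrow> 'a::comm_ring_1"
  assumes "degree Q \<le> k"
  shows "(\<Sum>j=1..n. poly (Polynomial.monom 1 i * Q) (\<theta> j)) = (\<Sum>l\<le>k. coeff Q l * power_sum n \<theta> (i + l))"
proof -
  have "poly Q x = (\<Sum>l\<le>k. coeff Q l * x ^ l)" for x
    unfolding poly_altdef using assms
    by (intro sum.mono_neutral_left) (auto intro: le_degree)
  then have "(\<Sum>j=1..n. poly (Polynomial.monom 1 i * Q) (\<theta> j)) =
      (\<Sum>j=1..n. \<Sum>l\<le>k. coeff Q l * \<theta> j ^ (i + l))"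
    by (simp add: poly_monom sum_distrib_left power_add mult_ac)
  also have "\<dots> = (\<Sum>l\<le>k. coeff Q l * power_sum n \<theta> (i + l))"
    unfolding power_sum_def sum_distrib_left by (rule sum.swap)
  finally show ?thesis .
qed

text \<open>For \<open>i \<le> k\<close> the product \<open>x^i R_k\<close> has degree at most
  \<open>n - 1\<close>, so the functional at \<open>x^i Q_k\<close> equals the coefficient of
  \<open>x^(n-1-i)\<close> in \<open>R_k\<close>. By the degree bound on \<open>R_k\<close> this is
  0 for \<open>i < k\<close>, and it is \<open>jacobi_lead\<close> for \<open>i = k\<close>.\<close>

lemma power_sum_det_jacobi:
  fixes a b :: "'a::field_char_0" and \<theta> :: "nat \<Rightarrow> 'a"
  assumes n: "n \<ge> 2" and t: "t \<le> n"
    and nz1: "\<And>j::nat. n + 1 \<le> j \<Longrightarrow> j \<le> 2 * n \<Longrightarrow> a + b + of_nat j \<noteq> 0"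
    and nz2: "\<And>j::nat. 2 * n - 2 * t + 3 \<le> j \<Longrightarrow> j \<le> 2 * n \<Longrightarrow> a + b + of_nat j \<noteq> 0"
    and roots: "jacobi n a b = (\<Prod>j\<in>{1..n}. [:- \<theta> j, 1:])"
  shows "power_sum_det n \<theta> t = (\<Prod>k<t. jacobi_lead n a b k)"
proof -
  have "\<forall>k. \<exists>Q. k < t \<longrightarrow> (\<exists>W. degree Q \<le> k \<and> coeff Q k = 1 \<and>
      Q * pderiv (jacobi n a b) = W * jacobi n a b + jacobi_rem n a b k)"
    using jacobi_convergents[OF n t nz1 nz2] by blast
  from choice[OF this] obtain Q where "\<forall>k. k < t \<longrightarrow> (\<exists>W. degree (Q k) \<le> k \<and> coeff (Q k) k = 1 \<and>
      Q k * pderiv (jacobi n a b) = W * jacobi n a b + jacobi_rem n a b k)"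
    by blast
  then have Q: "\<And>k. k < t \<Longrightarrow> degree (Q k) \<le> k" "\<And>k. k < t \<Longrightarrow> coeff (Q k) k = 1"
      "\<And>k. k < t \<Longrightarrow> \<exists>W. Q k * pderiv (jacobi n a b) = W * jacobi n a b + jacobi_rem n a b k"
    by blast+
  have L: "(\<Sum>l\<le>k. coeff (Q k) l * power_sum n \<theta> (i + l)) = coeff (jacobi_rem n a b k) (n - 1 - i)"
    if ik: "i \<le> k" "k < t" for i k
  proof -
    define S where "S = Polynomial.monom 1 i * jacobi_rem n a b k"
    obtain W where W: "Q k * pderiv (jacobi n a b) = W * jacobi n a b + jacobi_rem n a b k"
      using Q(3) ik by blast
    have "degree S \<le> i + (n - 1 - k)"
      unfolding S_def
      using degree_mult_le[of "Polynomial.monom 1 i" "jacobi_rem n a b k"] degree_jacobi_rem_le[of n a b k]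
        degree_monom_le[of "1 :: 'a" i] by linarith
    then have deg: "degree S < card {1..n}" using ik t by simp
    have div: "(Polynomial.monom 1 i * Q k) * pderiv (jacobi n a b) = (Polynomial.monom 1 i * W) * jacobi n a b + S"
      unfolding S_def mult.assoc W by (simp add: distrib_left)
    have "(\<Sum>j=1..n. poly (Polynomial.monom 1 i * Q k) (\<theta> j)) = coeff S (n - 1)"
      using sum_poly_eq_coeff_remainder[OF finite_atLeastAtMost roots div deg] by simp
    moreover have "coeff S (n - 1) = coeff (jacobi_rem n a b k) (n - 1 - i)"
      using ik t by (simp add: S_def coeff_monom_mult)
    ultimately show ?thesis using sum_poly_monom_mult[OF Q(1)] ik by metis
  qed
  show ?thesis
    unfolding power_sum_det_def
  proof (rule det_hankel_eq_prod)
    show "(\<Sum>l\<le>k. coeff (Q k) l * power_sum n \<theta> (i + l)) = 0" if "i < k" "k < t" for i k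
      using that t L[of i k] degree_jacobi_rem_le[of n a b k] by (simp add: coeff_eq_0)
    show "(\<Sum>l\<le>k. coeff (Q k) l * power_sum n \<theta> (k + l)) = jacobi_lead n a b k" if "k < t" for k
      using that L[of k k] by (simp only: coeff_jacobi_rem_top order_refl)
  qed (use Q in auto)
qed

section \<open>Evaluation of the product of the diagonal entries\<close>

text \<open>Raising \<open>t\<close> lowers the starting index of the products in \<open>A\<close>,
  \<open>B\<close> and \<open>C\<close> and so raises every exponent. This splits off one copy of
  each factor; the factor at \<open>u\<close> itself has exponent 0.\<close>

lemma prod_power_shift:
  fixes f :: "nat \<Rightarrow> 'a::comm_monoid_mult"
  shows "(\<Prod>j=u..n. f j ^ (j - u)) = (\<Prod>j=Suc u..n. f j) * (\<Prod>j=Suc u..n. f j ^ (j - Suc u))"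
proof (cases "u \<le> n")
  case True
  have "(\<Prod>j=u..n. f j ^ (j - u)) = (\<Prod>j=Suc u..n. f j ^ (j - u))"
    using prod.atLeast_Suc_atMost[OF True, of "\<lambda>j. f j ^ (j - u)"] by simp
  also have "\<dots> = (\<Prod>j=Suc u..n. f j * f j ^ (j - Suc u))"
    by (intro prod.cong) (auto simp flip: power_Suc simp: Suc_diff_Suc)
  finally show ?thesis by (simp add: prod.distrib)
qed auto

lemma pochhammer_of_nat_neq_0:
  fixes x :: "'a::field_char_0"
  assumes "\<And>j::nat. i \<le> j \<Longrightarrow> j < i + n \<Longrightarrow> x + of_nat j \<noteq> 0"
  shows "pochhammer (x + of_nat i) n \<noteq> 0"
proof
  assume "pochhammer (x + of_nat i) n = 0"
  then obtain k where "k < n" "x + of_nat i = - of_nat k"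
    by (auto simp: pochhammer_eq_0_iff)
  then show False using assms[of "i + k"] by (simp add: eq_neg_iff_add_eq_0 add.assoc)
qed

lemma jacobi_lead_0:
  assumes n: "n \<ge> 1" and nz: "\<And>j::nat. n + 1 \<le> j \<Longrightarrow> j \<le> 2 * n \<Longrightarrow> a + b + of_nat j \<noteq> (0::'a::field_char_0)"
  shows "jacobi_lead n a b 0 = of_nat n"
proof -
  have e: "a + b + of_nat (n - 1) + 3 = a + b + of_nat n + 2" using n by (cases n) auto
  have "pochhammer (a + b + of_nat n + 2) (n - 1) \<noteq> 0"
    using pochhammer_of_nat_neq_0[of "n + 2" "n - 1" "a + b"] nz by (simp add: add_ac)
  then show ?thesis by (simp only: jacobi_lead_def minus_nat.diff_0 e jacobi_scale.simps) simp
qed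

text \<open>With \<open>t = k + 1\<close>, the two sides are the factors by which \<open>C\<close>
  and \<open>A * B\<close> must change from \<open>t\<close> to \<open>t + 1\<close>, in
  cross-multiplied form. Here \<open>m\<close> is the degree bound of \<open>R_(k+1)\<close>; it
  falls as \<open>k\<close> grows with \<open>n\<close> fixed, so the induction generalises over
  it.\<close>

lemma jacobi_lead_prod:
  fixes a b :: "'a::field_char_0"
  assumes n: "n = Suc (Suc (k + m))"
    and nz1: "\<And>j::nat. n + 1 \<le> j \<Longrightarrow> j \<le> 2 * n \<Longrightarrow> a + b + of_nat j \<noteq> 0"
    and nz2: "\<And>j::nat. 2 * m + 3 \<le> j \<Longrightarrow> j \<le> 2 * n \<Longrightarrow> a + b + of_nat j \<noteq> 0"
  shows "jacobi_lead n a b (Suc k) *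
      ((\<Prod>j=2*m+3..2*n. a + b + of_nat j) * (\<Prod>j=2*m+4..2*n. a + b + of_nat j)) =
    (\<Prod>j=m+1..n. of_nat j) * (\<Prod>j=m+2..n. (a + of_nat j) * (b + of_nat j)) * (\<Prod>j=m+3..n. a + b + of_nat j)"
  using n nz2
proof (induction k arbitrary: m)
  case 0
  define s where "s = a + b"
  define N where "N = (of_nat n :: 'a)"
  have n: "n = Suc (Suc m)" using 0 by simp
  have m: "of_nat m = N - 2" by (simp add: N_def n)
  have "pochhammer (s + N + 1) n \<noteq> 0"
    using pochhammer_of_nat_neq_0[of "n + 1" n s] nz1 by (simp add: s_def N_def add_ac)
  \<comment> \<open>The scale has the denominators \<open>s + N + 1\<close> and
    \<open>(s + N + 2)_(n-1)\<close>, the claim has \<open>s + 2 * N - 1\<close> and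
    \<open>s + 2 * N\<close>. Splitting the first factor or the last two off the same Pochhammer
    symbol converts one into the other.\<close>
  moreover have "pochhammer (s + N + 1) n = (s + N + 1) * pochhammer (s + N + 2) (n - 1)"
    by (simp add: n pochhammer_rec add.assoc)
  moreover have "pochhammer (s + N + 1) n = pochhammer (s + N + 1) m * ((s + 2 * N - 1) * (s + 2 * N))"
    by (simp add: n pochhammer_Suc m algebra_simps)
  ultimately have nz: "s + N + 1 \<noteq> 0" "pochhammer (s + N + 2) (n - 1) \<noteq> 0" "s + 2 * N \<noteq> 0"
    "(s + N + 1) * pochhammer (s + N + 2) (n - 1) = pochhammer (s + N + 1) m * ((s + 2 * N - 1) * (s + 2 * N))"
    by auto
  have "jacobi_lead n a b (Suc 0) = N / pochhammer (s + N + 2) (n - 1) *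
      ((N - 1) * (N + a) * (N + b) / ((s + 2 * N) * (s + N + 1))) * pochhammer (s + N + 1) m"
    by (simp add: jacobi_lead_def s_def N_def n algebra_simps)
  then have "jacobi_lead n a b (Suc 0) * ((s + 2 * N) * ((s + N + 1) * pochhammer (s + N + 2) (n - 1)))
      = N * (N - 1) * (N + a) * (N + b) * pochhammer (s + N + 1) m"
    using nz(1-3) by simp
  then have "jacobi_lead n a b (Suc 0) * ((s + 2 * N) * ((s + 2 * N - 1) * (s + 2 * N))) * pochhammer (s + N + 1) m
      = N * (N - 1) * (N + a) * (N + b) * pochhammer (s + N + 1) m"
    unfolding nz(4) by (simp add: mult_ac)
  moreover have "pochhammer (s + N + 1) m \<noteq> 0" using nz(1,2,4) by auto
  ultimately have "jacobi_lead n a b (Suc 0) * ((s + 2 * N) * ((s + 2 * N - 1) * (s + 2 * N)))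
      = N * (N - 1) * (N + a) * (N + b)" by simp
  moreover have "{2*m+3..2*n} = {2*n-1, 2*n}" "{2*m+4..2*n} = {2*n}" "{m+1..n} = {n-1, n}" "{m+2..n} = {n}" "{m+3..n} = {}"
    by (auto simp: n)
  then have "(\<Prod>j=2*m+3..2*n. a + b + of_nat j) = (s + 2 * N - 1) * (s + 2 * N)"
    "(\<Prod>j=2*m+4..2*n. a + b + of_nat j) = s + 2 * N"
    "(\<Prod>j=m+1..n. of_nat j) = (N - 1) * N"
    "(\<Prod>j=m+2..n. (a + of_nat j) * (b + of_nat j)) = (a + N) * (b + N)"
    "(\<Prod>j=m+3..n. a + b + of_nat j) = 1"
    by (simp_all only: prod.insert prod.empty finite.intros) (simp_all add: n N_def s_def)
  ultimately show ?case by (simp only: mult_ac add_ac mult_1_left mult_1_right)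
next
  case (Suc k)
  define s where "s = a + b"
  define M where "M = (of_nat m :: 'a)"
  have n: "n = Suc (Suc (Suc (k + m)))" using Suc.prems by simp
  have nz: "s + 2 * M + 3 \<noteq> 0" "s + 2 * M + 4 \<noteq> 0" "s + 2 * M + 5 \<noteq> 0"
    using Suc.prems(2)[of "2 * m + 3"] Suc.prems(2)[of "2 * m + 4"] Suc.prems(2)[of "2 * m + 5"]
    by (simp_all add: n s_def M_def algebra_simps)
  define h where "h = jacobi_lead n a b (Suc k)"
  define h' where "h' = jacobi_lead n a b (Suc (Suc k))"
  define g where "g = jacobi_scale n a b (Suc k)"
  define P where "P = pochhammer (s + M + 4) (Suc m)"
  have h: "h = g * P"
    by (simp add: h_def jacobi_lead_def g_def P_def s_def M_def n algebra_simps)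
  have h': "h' = g * ((M + 1) * (M + a + 2) * (M + b + 2) / ((s + 2 * M + 4) * (s + 2 * M + 5))) * pochhammer (s + M + 3) m"
    by (simp add: h'_def jacobi_lead_def g_def Let_def s_def M_def n algebra_simps)
  \<comment> \<open>Again one Pochhammer symbol split at its first factor and at its last two. The
    factor \<open>s + M + 3\<close> produced here is the new factor \<open>a + b + (m + 3)\<close>
    of the last product.\<close>
  have P: "(s + M + 3) * P = pochhammer (s + M + 3) m * ((s + 2 * M + 3) * (s + 2 * M + 4))"
  proof -
    have "s + M + 4 = s + M + 3 + 1" by simp
    then have "(s + M + 3) * P = pochhammer (s + M + 3) (Suc (Suc m))"
      unfolding P_def by (simp only: pochhammer_rec)
    then show ?thesis by (simp add: pochhammer_Suc M_def algebra_simps)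
  qed
  have step: "h' * ((s + 2 * M + 3) * (s + 2 * M + 4) * ((s + 2 * M + 4) * (s + 2 * M + 5))) =
      h * ((M + 1) * ((a + (M + 2)) * (b + (M + 2))) * (s + (M + 3)))"
  proof -
    have "h' * ((s + 2 * M + 4) * (s + 2 * M + 5)) =
        g * ((M + 1) * (M + a + 2) * (M + b + 2)) * pochhammer (s + M + 3) m"
      unfolding h' using nz by simp
    note eq = this
    have "h' * ((s + 2 * M + 3) * (s + 2 * M + 4) * ((s + 2 * M + 4) * (s + 2 * M + 5))) =
        (h' * ((s + 2 * M + 4) * (s + 2 * M + 5))) * ((s + 2 * M + 3) * (s + 2 * M + 4))"
      by (simp only: mult_ac)
    also have "\<dots> = g * ((M + 1) * (M + a + 2) * (M + b + 2)) * (pochhammer (s + M + 3) m * ((s + 2 * M + 3) * (s + 2 * M + 4)))"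
      unfolding eq by (simp only: mult_ac)
    also have "\<dots> = h * ((M + 1) * ((a + (M + 2)) * (b + (M + 2))) * (s + (M + 3)))"
      unfolding P[symmetric] h by (simp add: add_ac mult_ac)
    finally show ?thesis .
  qed
  define S where "S i = (\<Prod>j=i..2*n. a + b + of_nat j)" for i
  define T where "T i = (\<Prod>j=i..n. a + b + of_nat j)" for i
  define A where "A i = (\<Prod>j=i..n. of_nat j :: 'a)" for i
  define B where "B i = (\<Prod>j=i..n. (a + of_nat j) * (b + of_nat j))" for i
  have IH: "h * (S (2 * m + 5) * S (2 * m + 6)) = A (m + 2) * B (m + 3) * T (m + 4)"
  proof -
    have "h * (S (2 * Suc m + 3) * S (2 * Suc m + 4)) = A (Suc m + 1) * B (Suc m + 2) * T (Suc m + 3)"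
      unfolding h_def S_def T_def A_def B_def by (rule Suc.IH) (use Suc.prems in auto)
    moreover have "2 * Suc m + 3 = 2 * m + 5" "2 * Suc m + 4 = 2 * m + 6"
      "Suc m + 1 = m + 2" "Suc m + 2 = m + 3" "Suc m + 3 = m + 4" by simp_all
    ultimately show ?thesis by (simp only:)
  qed
  have S: "S i = (s + of_nat i) * S (Suc i)" if "i \<le> 2 * n" for i
    unfolding S_def s_def using that by (rule prod.atLeast_Suc_atMost)
  have T: "T i = (s + of_nat i) * T (Suc i)" if "i \<le> n" for i
    unfolding T_def s_def using that by (rule prod.atLeast_Suc_atMost)
  have A: "A i = of_nat i * A (Suc i)" if "i \<le> n" for i
    unfolding A_def using that by (rule prod.atLeast_Suc_atMost)
  have B: "B i = ((a + of_nat i) * (b + of_nat i)) * B (Suc i)" if "i \<le> n" for i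
    unfolding B_def using that by (rule prod.atLeast_Suc_atMost)
  have S3: "S (2 * m + 3) = (s + 2 * M + 3) * (s + 2 * M + 4) * S (2 * m + 5)"
    and S4: "S (2 * m + 4) = (s + 2 * M + 4) * (s + 2 * M + 5) * S (2 * m + 6)"
    using S[of "2 * m + 3"] S[of "2 * m + 4"] S[of "2 * m + 5"]
    by (simp_all add: n M_def add_ac mult_ac)
  have "h' * (S (2 * m + 3) * S (2 * m + 4)) =
      (h' * ((s + 2 * M + 3) * (s + 2 * M + 4) * ((s + 2 * M + 4) * (s + 2 * M + 5)))) * (S (2 * m + 5) * S (2 * m + 6))"
    unfolding S3 S4 by (simp only: mult_ac)
  also have "\<dots> = ((M + 1) * ((a + (M + 2)) * (b + (M + 2))) * (s + (M + 3))) * (h * (S (2 * m + 5) * S (2 * m + 6)))"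
    unfolding step by (simp only: mult_ac)
  also have "\<dots> = ((M + 1) * A (m + 2)) * (((a + (M + 2)) * (b + (M + 2))) * B (m + 3)) * ((s + (M + 3)) * T (m + 4))"
    unfolding IH by (simp only: mult_ac)
  also have "\<dots> = A (m + 1) * B (m + 2) * T (m + 3)"
    using A[of "m + 1"] B[of "m + 2"] T[of "m + 3"] by (simp add: n M_def add_ac numeral_eq_Suc)
  finally show ?case unfolding h'_def S_def T_def A_def B_def .
qed

text \<open>Induction on \<open>t\<close>, with \<open>jacobi_lead_prod\<close> supplying the new
  factor. The form without division lets the factors be regrouped freely.\<close>

lemma prod_jacobi_lead:
  assumes "1 \<le> t" "t \<le> n"
    and nz1: "\<And>j::nat. n + 1 \<le> j \<Longrightarrow> j \<le> 2 * n \<Longrightarrow> \<alpha> + \<beta> + of_nat j \<noteq> (0::rat)"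
    and nz2: "\<And>j::nat. 2 * n - 2 * t + 3 \<le> j \<Longrightarrow> j \<le> 2 * n \<Longrightarrow> \<alpha> + \<beta> + of_nat j \<noteq> 0"
  shows "(\<Prod>k<t. jacobi_lead n \<alpha> \<beta> k) * C_coeff n \<alpha> \<beta> t = A_coeff n t * B_coeff n \<alpha> \<beta> t"
  using assms(1,2) nz2
proof (induction t rule: nat_induct_at_least)
  case base
  have "C_coeff n \<alpha> \<beta> 1 = 1" "B_coeff n \<alpha> \<beta> 1 = 1" "A_coeff n 1 = of_nat n"
  proof -
    have i: "2 * n - 2 * 1 + 2 = 2 * n" "n - 1 + 2 = Suc n" "n - 1 + 1 = n" using base by simp_all
    show "C_coeff n \<alpha> \<beta> 1 = 1" "B_coeff n \<alpha> \<beta> 1 = 1" "A_coeff n 1 = of_nat n"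
      unfolding C_coeff_def B_coeff_def A_coeff_def i using base by simp_all
  qed
  then show ?case using jacobi_lead_0[OF base(1) nz1] by simp
next
  case (Suc t)
  obtain k where t: "t = Suc k" using Suc.hyps by (cases t) auto
  define m where "m = n - 2 - k"
  have n: "n = Suc (Suc (k + m))" using Suc.prems by (simp add: m_def t)
  have IH: "(\<Prod>k<t. jacobi_lead n \<alpha> \<beta> k) * C_coeff n \<alpha> \<beta> t = A_coeff n t * B_coeff n \<alpha> \<beta> t"
    using Suc by auto
  have L: "jacobi_lead n \<alpha> \<beta> t *
      ((\<Prod>j=2*m+3..2*n. \<alpha> + \<beta> + of_nat j) * (\<Prod>j=2*m+4..2*n. \<alpha> + \<beta> + of_nat j)) =
    (\<Prod>j=m+1..n. of_nat j) * (\<Prod>j=m+2..n. (\<alpha> + of_nat j) * (\<beta> + of_nat j)) * (\<Prod>j=m+3..n. \<alpha> + \<beta> + of_nat j)"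
    unfolding t using Suc.prems(2) by (intro jacobi_lead_prod[OF n nz1]) (auto simp: n t)
  have i: "n - Suc t = m" "n - t = Suc m" "2 * n - 2 * Suc t = 2 * m" "2 * n - 2 * t = 2 * m + 2"
    by (simp_all add: n t)
  \<comment> \<open>The starting index of \<open>C\<close> drops by two when \<open>t\<close> grows
    by one, so the shift is applied twice.\<close>
  have C: "C_coeff n \<alpha> \<beta> (Suc t) = (\<Prod>j=2*m+3..2*n. \<alpha> + \<beta> + of_nat j) *
      (\<Prod>j=2*m+4..2*n. \<alpha> + \<beta> + of_nat j) * C_coeff n \<alpha> \<beta> t"
    unfolding C_coeff_def i
    using prod_power_shift[of "\<lambda>j. \<alpha> + \<beta> + of_nat j" "2*m+2" "2*n"]
      prod_power_shift[of "\<lambda>j. \<alpha> + \<beta> + of_nat j" "2*m+3" "2*n"]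
    by (simp add: numeral_eq_Suc)
  have A: "A_coeff n (Suc t) = (\<Prod>j=m+1..n. of_nat j) * A_coeff n t"
  proof -
    \<comment> \<open>Extends the products in \<open>A\<close> down to the index that
      \<open>prod_power_shift\<close> starts from. The added factor has exponent 0, hence equals 1
      even for \<open>m = 0\<close>.\<close>
    have "(\<Prod>j=m..n. of_nat j ^ (j - m)) = (\<Prod>j=Suc m..n. of_nat j ^ (j - m) :: rat)"
      using prod.atLeast_Suc_atMost[of m n "\<lambda>j. of_nat j ^ (j - m) :: rat"] by (simp add: n)
    moreover have "(\<Prod>j=Suc m..n. of_nat j ^ (j - Suc m)) = (\<Prod>j=Suc (Suc m)..n. of_nat j ^ (j - Suc m) :: rat)"
      using prod.atLeast_Suc_atMost[of "Suc m" n "\<lambda>j. of_nat j ^ (j - Suc m) :: rat"] by (simp add: n)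
    ultimately show ?thesis
      unfolding A_coeff_def i using prod_power_shift[of "of_nat :: nat \<Rightarrow> rat" m n] by simp
  qed
  have B: "B_coeff n \<alpha> \<beta> (Suc t) = (\<Prod>j=m+2..n. (\<alpha> + of_nat j) * (\<beta> + of_nat j)) *
      (\<Prod>j=m+3..n. \<alpha> + \<beta> + of_nat j) * B_coeff n \<alpha> \<beta> t"
  proof -
    \<comment> \<open>In \<open>B\<close> the two kinds of factors share the range of
      \<open>j\<close>, but their exponents differ by one; \<open>F\<close> and \<open>G\<close>
      separate them so that each can be shifted.\<close>
    define F where "F u = (\<Prod>j=u..n. ((\<alpha> + of_nat j) * (\<beta> + of_nat j)) ^ (j - u))" for u
    define G where "G u = (\<Prod>j=u..n. (\<alpha> + \<beta> + of_nat j) ^ (j - u))" for u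
    have F: "(\<Prod>j=Suc u..n. ((\<alpha> + of_nat j) * (\<beta> + of_nat j)) ^ (j - u)) = F u" if "u \<le> n" for u
      unfolding F_def using prod.atLeast_Suc_atMost[OF that, of "\<lambda>j. ((\<alpha> + of_nat j) * (\<beta> + of_nat j)) ^ (j - u)"] by simp
    have "B_coeff n \<alpha> \<beta> (Suc t) = F (m + 1) * G (m + 2)"
      unfolding B_coeff_def i prod.distrib using F[of "m + 1"] by (simp add: n G_def)
    moreover have "B_coeff n \<alpha> \<beta> t = F (m + 2) * G (m + 3)"
      unfolding B_coeff_def i prod.distrib using F[of "m + 2"] by (simp add: n G_def numeral_eq_Suc)
    moreover have "F (m + 1) = (\<Prod>j=m+2..n. (\<alpha> + of_nat j) * (\<beta> + of_nat j)) * F (m + 2)"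
      unfolding F_def using prod_power_shift[of "\<lambda>j. (\<alpha> + of_nat j) * (\<beta> + of_nat j)" "m + 1" n] by simp
    moreover have "G (m + 2) = (\<Prod>j=m+3..n. \<alpha> + \<beta> + of_nat j) * G (m + 3)"
      unfolding G_def using prod_power_shift[of "\<lambda>j. \<alpha> + \<beta> + of_nat j" "m + 2" n] by (simp add: numeral_eq_Suc)
    ultimately show ?thesis by (simp add: mult_ac)
  qed
  have "(\<Prod>k<Suc t. jacobi_lead n \<alpha> \<beta> k) * C_coeff n \<alpha> \<beta> (Suc t) =
    (jacobi_lead n \<alpha> \<beta> t *
      ((\<Prod>j=2*m+3..2*n. \<alpha> + \<beta> + of_nat j) * (\<Prod>j=2*m+4..2*n. \<alpha> + \<beta> + of_nat j))) *
    ((\<Prod>k<t. jacobi_lead n \<alpha> \<beta> k) * C_coeff n \<alpha> \<beta> t)"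
    unfolding C prod.lessThan_Suc by (simp only: mult_ac)
  also have "\<dots> = A_coeff n (Suc t) * B_coeff n \<alpha> \<beta> (Suc t)"
    unfolding L IH A B by (simp only: mult_ac)
  finally show ?case .
qed

section \<open>Passage to the algebraic closure of the rationals\<close>

lemma to_ac_pochhammer: "to_ac (pochhammer x n) = pochhammer (to_ac x) n"
  by (simp add: pochhammer_prod to_ac_prod)

lemma to_ac_jacobi_scale: "to_ac (jacobi_scale n a b k) = jacobi_scale n (to_ac a) (to_ac b) k"
  by (induction n a b k rule: jacobi_scale.induct)
    (simp_all add: to_ac_pochhammer Let_def)

lemma to_ac_jacobi_lead: "to_ac (jacobi_lead n a b k) = jacobi_lead n (to_ac a) (to_ac b) k"
  by (simp add: jacobi_lead_def to_ac_pochhammer to_ac_jacobi_scale)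

text \<open>The denominators of the coefficient of \<open>x^j\<close> multiply to
  \<open>(q + 1)_n / (q + 1)_j\<close>. This quotient is legitimate because the hypothesis excludes
  zeros of all \<open>(q + 1)_i\<close> with \<open>i \<le> n\<close>.\<close>

lemma map_poly_jacobi_poly:
  assumes nz: "\<And>j::nat. n + 1 \<le> j \<Longrightarrow> j \<le> 2 * n \<Longrightarrow> \<alpha> + \<beta> + of_nat j \<noteq> 0"
  shows "map_poly to_ac (jacobi_poly n \<alpha> \<beta>) = jacobi n (to_ac \<alpha>) (to_ac \<beta>)"
proof (rule poly_eqI)
  fix j
  define q where "q = \<alpha> + \<beta> + of_nat n"
  have P: "pochhammer (q + 1) i = (\<Prod>k=1..i. of_nat n + \<alpha> + \<beta> + of_nat k)" for i
    unfolding pochhammer_prod by (rule prod.reindex_bij_witness[of _ "\<lambda>k. k - 1" Suc]) (auto simp: q_def add_ac)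
  have nzP: "pochhammer (q + 1) i \<noteq> 0" if "i \<le> n" for i
    using pochhammer_of_nat_neq_0[of "n + 1" i "\<alpha> + \<beta>"] nz that by (simp add: q_def add_ac)
  have "coeff (jacobi_poly n \<alpha> \<beta>) j = 1 / pochhammer (q + 1) n * (hyp_weight \<alpha> n j * pochhammer (q + 1) j)"
  proof (cases "j \<le> n")
    case True
    have num: "(\<Prod>k=j+1..n. \<alpha> + of_nat k) = pochhammer (\<alpha> + of_nat j + 1) (n - j)"
      unfolding pochhammer_prod using True
      by (intro prod.reindex_bij_witness[of _ "\<lambda>i. i + j + 1" "\<lambda>k. k - j - 1"]) (auto simp: add_ac of_nat_diff)
    have "pochhammer (q + 1) n = pochhammer (q + 1) j * (\<Prod>k=j+1..n. of_nat n + \<alpha> + \<beta> + of_nat k)"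
      unfolding P
      using prod.ub_add_nat[of 1 j "\<lambda>k. of_nat n + \<alpha> + \<beta> + of_nat k" "n - j"] True by simp
    then have den: "(\<Prod>k=j+1..n. of_nat n + \<alpha> + \<beta> + of_nat k) = pochhammer (q + 1) n / pochhammer (q + 1) j"
      using nzP[OF True] by simp
    have "coeff (jacobi_poly n \<alpha> \<beta>) j = of_nat (n choose j) *
         (\<Prod>k=j+1..n. (\<alpha> + of_nat k) / (of_nat n + \<alpha> + \<beta> + of_nat k)) * (-1) ^ (n - j)"
      using True by (simp add: jacobi_poly_def coeff_sum)
    also have "\<dots> = of_nat (n choose j) * (pochhammer (\<alpha> + of_nat j + 1) (n - j) /
        (pochhammer (q + 1) n / pochhammer (q + 1) j)) * (-1) ^ (n - j)"
      unfolding prod_dividef num den ..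
    finally show ?thesis by (simp add: hyp_weight_def)
  qed (simp add: jacobi_poly_def coeff_sum hyp_weight_eq_0)
  then show "coeff (map_poly to_ac (jacobi_poly n \<alpha> \<beta>)) j = coeff (jacobi n (to_ac \<alpha>) (to_ac \<beta>)) j"
    by (simp add: coeff_map_poly jacobi_def coeff_hyp_poly hyp_weight_def to_ac_pochhammer q_def)
qed

text \<open>Over an algebraically closed field \<open>p\<close> splits into linear factors. The
  multiset of the factorisation is \<open>proots p\<close>, so the enumeration
  \<open>\<theta>\<close> turns it into an indexed product.\<close>

lemma monic_eq_prod_proots:
  fixes p :: "'a::alg_closed_field poly"
  assumes "lead_coeff p = 1" and "image_mset \<theta> (mset_set J) = proots p"
  shows "p = (\<Prod>j\<in>J. [:- \<theta> j, 1:])"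
proof -
  have "p \<noteq> 0" using assms(1) by auto
  then obtain A where "p = smult (lead_coeff p) (\<Prod>x\<in>#A. [:- x, 1:])"
    using alg_closed_imp_factorization by blast
  with assms(1) have A: "p = (\<Prod>x\<in>#A. [:- x, 1:])" by simp
  have "proots (\<Prod>x\<in>#A. [:- x, 1:]) = A" for A :: "'a multiset"
  proof (induction A)
    case (add x A)
    have "(\<Prod>x\<in>#A. [:- x, 1:]) \<noteq> 0" by (auto simp: prod_mset_zero_iff)
    then have "proots ([:- x, 1:] * (\<Prod>x\<in>#A. [:- x, 1:])) = proots [:- x, 1:] + proots (\<Prod>x\<in>#A. [:- x, 1:])"
      by (intro proots_mult) auto
    then show ?case using add.IH proots_linear_factor[of "- x"] by simp
  qed simp
  then have "A = proots p" unfolding A by (rule sym)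
  then have "p = (\<Prod>x\<in>#proots p. [:- x, 1:])" using A by blast
  also have "\<dots> = (\<Prod>j\<in>J. [:- \<theta> j, 1:])"
    unfolding assms(2)[symmetric] prod_unfold_prod_mset by (simp add: multiset.map_comp comp_def)
  finally show ?thesis .
qed

theorem theorem13:
  fixes n t :: nat and \<alpha> \<beta> :: rat and \<theta> :: "nat \<Rightarrow> rat alg_closure"
  assumes "n \<ge> 2" and "1 \<le> t" and "t \<le> n"
    and "\<And>j :: nat. n + 1 \<le> j \<Longrightarrow> j \<le> 2 * n \<Longrightarrow> \<alpha> + \<beta> + of_nat j \<noteq> 0"
    and "\<And>j :: nat. 2 * n - 2 * t + 3 \<le> j \<Longrightarrow> j \<le> 2 * n \<Longrightarrow> \<alpha> + \<beta> + of_nat j \<noteq> 0"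
    and "image_mset \<theta> (mset_set {1..n}) = proots (map_poly to_ac (jacobi_poly n \<alpha> \<beta>))"
  shows "power_sum_det n \<theta> t = to_ac (A_coeff n t * B_coeff n \<alpha> \<beta> t / C_coeff n \<alpha> \<beta> t)"
proof -
  define a where "a = to_ac \<alpha>"
  define b where "b = to_ac \<beta>"
  have ab: "a + b + of_nat j = to_ac (\<alpha> + \<beta> + of_nat j)" for j by (simp add: a_def b_def)
  have nz1: "a + b + of_nat j \<noteq> 0" if "n + 1 \<le> j" "j \<le> 2 * n" for j :: nat
    unfolding ab to_ac_eq_0_iff using that by (rule assms(4))
  have nz2: "a + b + of_nat j \<noteq> 0" if "2 * n - 2 * t + 3 \<le> j" "j \<le> 2 * n" for j :: nat
    unfolding ab to_ac_eq_0_iff using that by (rule assms(5))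
  have J: "map_poly to_ac (jacobi_poly n \<alpha> \<beta>) = jacobi n a b"
    unfolding a_def b_def using assms(4) by (rule map_poly_jacobi_poly)
  have poch: "pochhammer (a + b + of_nat n + 1) n \<noteq> 0"
    using pochhammer_of_nat_neq_0[of "n + 1" n "a + b"] nz1 by (simp add: add_ac)
  then have top: "coeff (jacobi n a b) n = 1"
    by (simp add: jacobi_def coeff_hyp_poly hyp_weight_def)
  have "degree (jacobi n a b) \<le> n"
    unfolding jacobi_def by (rule order.trans[OF degree_smult_le degree_hyp_poly_le])
  moreover have "n \<le> degree (jacobi n a b)" using top by (intro le_degree) simp
  ultimately have "lead_coeff (jacobi n a b) = 1" using top by simp
  then have roots: "jacobi n a b = (\<Prod>j\<in>{1..n}. [:- \<theta> j, 1:])"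
    using assms(6) unfolding J by (rule monic_eq_prod_proots)
  have "power_sum_det n \<theta> t = (\<Prod>k<t. jacobi_lead n a b k)"
    by (rule power_sum_det_jacobi[OF assms(1,3) nz1 nz2 roots])
  also have "\<dots> = to_ac (\<Prod>k<t. jacobi_lead n \<alpha> \<beta> k)"
    by (simp add: to_ac_prod to_ac_jacobi_lead a_def b_def)
  also have "(\<Prod>k<t. jacobi_lead n \<alpha> \<beta> k) = A_coeff n t * B_coeff n \<alpha> \<beta> t / C_coeff n \<alpha> \<beta> t"
  proof -
    \<comment> \<open>The hypothesis covers the factors from \<open>j = 2 * n - 2 * t + 3\<close>
      on; the one at \<open>2 * n - 2 * t + 2\<close> has exponent 0 and equals 1.\<close>
    have "C_coeff n \<alpha> \<beta> t \<noteq> 0"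
      unfolding C_coeff_def
    proof (subst prod_zero_iff, simp, clarify)
      fix j assume j: "j \<in> {2 * n - 2 * t + 2..2 * n}"
        "(\<alpha> + \<beta> + of_nat j) ^ (j - (2 * n - 2 * t + 2)) = 0"
      then show False using assms(5)[of j] by (cases "j = 2 * n - 2 * t + 2") auto
    qed
    then show ?thesis
      using prod_jacobi_lead[OF assms(2-5)] by (simp add: eq_divide_eq)
  qed
  finally show ?thesis .
qed

end
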